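(* Let $n\ge 2$ and let $X=(x_{ij})$ be a symmetric $n\times n$ matrix. Then for all $1\le i<j\le n$, $$x_{ij}\;=\;\sum_{C} W_{\mathscr C}(C),$$ where the sum runs over all Catalan paths $C$ in $G_n$ from node $i$ to node $j$. This is an identity of rational functions in the entries of a generic symmetric matrix; equivalently, it holds for every real or complex symmetric matrix for which all principal minors occurring in the denominators are nonzero. (For $j<i$ one has $x_{ij}=x_{ji}$ by symmetry.)
   Context: Minors: for an $n\times n$ matrix $X$ and $I,J\subseteq[n]=\{1,\dots,n\}$ with $|I|=|J|$, $X^J_I$ denotes the determinant of the submatrix with row indices $I$ and column indices $J$, both taken in increasing order (the empty minor is $1$). Set $p_I=(-1)^{\lfloor |I|/2\rfloor}X^I_I$ (so $p_\emptyset=1$), and for distinct $i,j\notin I$ set $a_{ij|I}=(-1)^{\lceil |I|/2\rceil}X^{\{j\}\cup I}_{\{i\}\cup I}$. The graph $G_n$: its vertices are the lattice points $(x,y)\in\mathbb Z^2$ with $0\le y\le x$, $x+y\le 2n-2$, $x+y$ even; edges are northeast steps $(1,1)$ and southeast steps $(1,-1)$. For $1\le k\le n$, "node $k$" is the vertex $(2k-2,0)$. Each vertex $v=(x,y)$ with $y\ge 1$ carries labels: put $i=(x-y+2)/2$, $j=(x+y+2)/2$ (so $1\le i<j\le n$) and $I(v)=\{i+1,\dots,j-1\}$; define $A(v)=a_{ij|I(v)}$ and $P(v)=p_{I(v)}$ ($P(v)$ is the label of the region of $G_n$ directly below $v$, i.e. the region whose top vertex is $v$; it equals $p_\emptyset=1$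 when $y=1$). Vertices on the $x$-axis carry no minor label. A Catalan path from node $i$ to node $j$ ($i<j$) is a sequence of lattice points $v_0,\dots,v_m$ with $v_0=(2i-2,0)$, $v_m=(2j-2,0)$, every step $v_{k+1}-v_k\in\{(1,1),(1,-1)\}$, and all $y$-coordinates $\ge 0$. A local maximum is a $v_k$ with $0<k<m$ whose two neighbours $v_{k-1},v_{k+1}$ both have smaller $y$-coordinate; a local minimum is a $v_k$ with $0<k<m$ whose two neighbours both have larger $y$-coordinate. The weight is the Laurent monomial $$W_{\mathscr C}(C)=\prod_{v\ \text{local max}}\frac{A(v)}{P(v)}\cdot\frac{\prod_{v=(x,y)\ \text{local min},\ y\ge1}A(v)}{\prod_{(x,y)\ \text{local min}}P\big((x,y+2)\big)},$$ i.e. the numerator is the product of the labels $a_{ij|I}$ of the local maxima and of the local minima above the $x$-axis, and the denominator is the product of the labels $p_I$ of the regions immediately below each local maximum and immediately above each local minimum. *)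

theory Defs
  imports "Jordan_Normal_Form.Determinant" "Jordan_Normal_Form.DL_Submatrix"
begin

text \<open>Row and column indices are 1-based, as in \<open>[n] = {1..n}\<close>, whereas the entries of a
  matrix in \<open>Jordan_Normal_Form\<close> are addressed from 0; this is the reason for the shift by 1.
  The index sets are meant to be subsets of \<open>{1..n}\<close>.\<close>

definition minor :: "'a::comm_ring_1 mat \<Rightarrow> nat set \<Rightarrow> nat set \<Rightarrow> 'a" where
  "minor X I J = det (submatrix X ((\<lambda>k. k - 1) ` I) ((\<lambda>k. k - 1) ` J))"

definition p_minor :: "'a::comm_ring_1 mat \<Rightarrow> nat set \<Rightarrow> 'a" where
  "p_minor X I = (- 1) ^ (card I div 2) * minor X I I"

text \<open>On naturals, \<open>(m + 1) div 2\<close> is the ceiling of \<open>m/2\<close>.\<close>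

definition a_minor :: "'a::comm_ring_1 mat \<Rightarrow> nat \<Rightarrow> nat \<Rightarrow> nat set \<Rightarrow> 'a" where
  "a_minor X i j I = (- 1) ^ ((card I + 1) div 2) * minor X ({i} \<union> I) ({j} \<union> I)"


type_synonym point = "int \<times> int"

definition steps :: "(point \<times> point) set" where
  "steps = {((x, y), (x', y')). x' = x + 1 \<and> (y' = y + 1 \<or> y' = y - 1)}"

definition G_verts :: "nat \<Rightarrow> point set" where
  "G_verts n = {(x, y). 0 \<le> y \<and> y \<le> x \<and> x + y \<le> 2 * int n - 2 \<and> even (x + y)}"

definition G_edges :: "nat \<Rightarrow> (point \<times> point) set" where
  "G_edges n = {(u, v). u \<in> G_verts n \<and> v \<in> G_verts n \<and> (u, v) \<in> steps}"

definition node :: "nat \<Rightarrow> point" where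
  "node k = (2 * int k - 2, 0)"

text \<open>For a vertex of \<open>G_verts n\<close> both divisions below are exact and
  \<open>1 \<le> left_index v \<le> right_index v \<le> n\<close>.\<close>

definition left_index :: "point \<Rightarrow> nat" where
  "left_index v = nat ((fst v - snd v + 2) div 2)"

definition right_index :: "point \<Rightarrow> nat" where
  "right_index v = nat ((fst v + snd v + 2) div 2)"

definition inner_indices :: "point \<Rightarrow> nat set" where
  "inner_indices v = {left_index v + 1..right_index v - 1}"

definition A_label :: "'a::comm_ring_1 mat \<Rightarrow> point \<Rightarrow> 'a" where
  "A_label X v = a_minor X (left_index v) (right_index v) (inner_indices v)"

definition P_label :: "'a::comm_ring_1 mat \<Rightarrow> point \<Rightarrow> 'a" where
  "P_label X v = p_minor X (inner_indices v)"


text \<open>A path is the list of the lattice points that it visits.\<close>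

definition catalan_path :: "nat \<Rightarrow> nat \<Rightarrow> point list \<Rightarrow> bool" where
  "catalan_path i j C \<longleftrightarrow>
     C \<noteq> [] \<and> hd C = node i \<and> last C = node j \<and>
     (\<forall>k. Suc k < length C \<longrightarrow> (C ! k, C ! Suc k) \<in> steps) \<and>
     (\<forall>v \<in> set C. 0 \<le> snd v)"

definition path_in_G :: "nat \<Rightarrow> point list \<Rightarrow> bool" where
  "path_in_G n C \<longleftrightarrow>
     set C \<subseteq> G_verts n \<and> (\<forall>k. Suc k < length C \<longrightarrow> (C ! k, C ! Suc k) \<in> G_edges n)"

definition catalan_paths :: "nat \<Rightarrow> nat \<Rightarrow> nat \<Rightarrow> point list set" where
  "catalan_paths n i j = {C. catalan_path i j C \<and> path_in_G n C}"

text \<open>Local extrema are recorded by their positions in the list, never at an endpoint.\<close>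

definition local_max :: "point list \<Rightarrow> nat set" where
  "local_max C = {k. 0 < k \<and> Suc k < length C \<and>
     snd (C ! (k - 1)) < snd (C ! k) \<and> snd (C ! Suc k) < snd (C ! k)}"

definition local_min :: "point list \<Rightarrow> nat set" where
  "local_min C = {k. 0 < k \<and> Suc k < length C \<and>
     snd (C ! k) < snd (C ! (k - 1)) \<and> snd (C ! k) < snd (C ! Suc k)}"

text \<open>The region directly above a vertex \<open>v\<close> is the one whose top vertex is \<open>two_above v\<close>.\<close>

definition two_above :: "point \<Rightarrow> point" where
  "two_above v = (fst v, snd v + 2)"

definition path_weight :: "'a::field mat \<Rightarrow> point list \<Rightarrow> 'a" where
  "path_weight X C =
     (\<Prod>k \<in> local_max C. A_label X (C ! k) / P_label X (C ! k)) *
     ((\<Prod>k \<in> {k \<in> local_min C. 1 \<le> snd (C ! k)}. A_label X (C ! k)) /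
      (\<Prod>k \<in> local_min C. P_label X (two_above (C ! k))))"

text \<open>The top vertices of the regions whose labels occur in the denominator of the weight.\<close>

definition denom_regions :: "point list \<Rightarrow> point set" where
  "denom_regions C = (\<lambda>k. C ! k) ` local_max C \<union> (\<lambda>k. two_above (C ! k)) ` local_min C"


text \<open>The sum over \<open>catalan_paths n i j\<close> is a genuine finite sum.\<close>

lemma finite_G_verts: "finite (G_verts n)"
proof (rule finite_subset)
  show "G_verts n \<subseteq> {0..2 * int n} \<times> {0..2 * int n}"
    by (auto simp: G_verts_def)
qed simp

lemma finite_catalan_paths: "finite (catalan_paths n i j)"
proof (rule finite_subset)
  show "catalan_paths n i j \<subseteq> {C. set C \<subseteq> G_verts n \<and> distinct C}"
  proof safe
    fix C assume C: "C \<in> catalan_paths n i j"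
    then show "\<And>x y. (x, y) \<in> set C \<Longrightarrow> (x, y) \<in> G_verts n"
      by (auto simp: catalan_paths_def path_in_G_def)
    have step: "fst (C ! Suc k) = fst (C ! k) + 1" if "Suc k < length C" for k
      using C that by (auto simp: catalan_paths_def catalan_path_def steps_def)
    have fst_nth: "fst (C ! k) = fst (C ! 0) + int k" if "k < length C" for k
      using that by (induction k) (simp_all add: step)
    show "distinct C"
      unfolding distinct_conv_nth
    proof (intro allI impI notI)
      fix k l assume "k < length C" "l < length C" "k \<noteq> l" "C ! k = C ! l"
      then show False using fst_nth[of k] fst_nth[of l] by simp
    qed
  qed
  show "finite {C. set C \<subseteq> G_verts n \<and> distinct C}"
    by (rule finite_subset_distinct[OF finite_G_verts])
qed

end

theory Submission
  imports Defs
begin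

text \<open>Regard \<open>X\<close> as a symmetric bilinear form. For an interval \<open>a..b\<close> of indices let the forward
  residual be \<open>e\<^sub>a\<close> minus its projection onto \<open>e\<^sub>k\<close>, \<open>a < k \<le> b\<close>, and the backward residual be \<open>e\<^sub>b\<close>
  minus its projection onto \<open>e\<^sub>k\<close>, \<open>a \<le> k < b\<close>. By Cramer's rule the norms of the residuals are
  ratios of consecutive principal minors, and \<open>A(v)/P(v)\<close> at the vertex with indices \<open>a < b\<close> is the
  pairing of \<open>e\<^sub>a\<close> with the backward residual of \<open>a+1..b\<close>. One step of Gram-Schmidt expresses the
  two residuals of \<open>a..b\<close> through those of \<open>a..b-1\<close> and \<open>a+1..b\<close>, as in the Levinson recursion.

  Sum the weights of all partial paths from node \<open>i\<close> to a vertex, separately for those that arrive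
  by a down step and by an up step. Extending the paths by one step gives the same recursion, so
  the down sum is the pairing of \<open>e\<^sub>i\<close> with a backward residual, and the up sum is the coefficient
  of \<open>e\<^sub>a\<close> in the projection of \<open>e\<^sub>i\<close> onto \<open>e\<^sub>a, \<dots>, e\<^bsub>b-1\<^esub>\<close>. At node \<open>j\<close> the backward
  residual is \<open>e\<^sub>j\<close> itself and the sum is \<open>x\<^bsub>ij\<^esub>\<close>.\<close>

section \<open>Minors and residuals\<close>

text \<open>Vectors are coefficient functions on \<open>{..N}\<close>, so that residuals of
  different intervals live in one space. This is the form evaluated at \<open>e\<^sub>l\<close> and
  \<open>z\<close>.\<close>

definition pairing :: "(nat \<Rightarrow> nat \<Rightarrow> 'a::comm_ring_1) \<Rightarrow> nat \<Rightarrow> nat \<Rightarrow> (nat \<Rightarrow> 'a) \<Rightarrow> 'a" where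
  "pairing x N l z = (\<Sum>k\<le>N. x l k * z k)"

definition block :: "(nat \<Rightarrow> nat \<Rightarrow> 'a) \<Rightarrow> nat \<Rightarrow> nat \<Rightarrow> nat \<Rightarrow> 'a mat" where
  "block x r c s = mat s s (\<lambda>(p, q). x (r + p) (c + q))"

lemma block_carrier [simp]: "block x r c s \<in> carrier_mat s s"
  by (simp add: block_def)

lemma pick_interval: "p < s \<Longrightarrow> pick {r..<r + s} p = r + p"
proof -
  assume p: "p < s"
  have "card {a \<in> {r..<r + s}. a < r + p} = p"
  proof -
    have "{a \<in> {r..<r + s}. a < r + p} = {r..<r + p}" using p by auto
    then show ?thesis by simp
  qed
  then show ?thesis using pick_card_in_set[of "r + p" "{r..<r + s}"] p by simp
qed

lemma minor_interval:
  assumes X: "X \<in> carrier_mat n n" and "1 \<le> r" "1 \<le> c" "r + s \<le> n + 1" "c + s \<le> n + 1"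
  shows "minor X {r..<r + s} {c..<c + s} = det (block (\<lambda>k l. X $$ (k - 1, l - 1)) r c s)"
proof -
  \<comment> \<open>Truncated subtraction would identify 0 and 1; on intervals that start at a
    successor it is a faithful shift.\<close>
  obtain r' c' where rc: "r = Suc r'" "c = Suc c'"
    using assms(2,3) by (metis One_nat_def Suc_le_D)
  have img: "(\<lambda>k. k - 1) ` {Suc t..<Suc t + s} = {t..<t + s}" for t :: nat
    using image_minus_const_atLeastLessThan_nat[of 1 "Suc t" "Suc t + s"] by simp
  have cnt: "{k. k < n \<and> k \<in> {t..<t + s}} = {t..<t + s}" if "t + s \<le> n" for t :: nat
    using that by auto
  have "r' + s \<le> n" "c' + s \<le> n" using assms(4,5) rc by simp_all
  then have "submatrix X {r'..<r' + s} {c'..<c' + s} = block (\<lambda>k l. X $$ (k - 1, l - 1)) r c s"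
    using X unfolding submatrix_def block_def rc
    by (simp only: carrier_matD cnt card_atLeastLessThan)
       (auto intro!: cong_mat simp: pick_interval)
  then show ?thesis by (simp only: minor_def rc img)
qed

text \<open>Cramer's rule: replacing column \<open>q0\<close> by the block applied to
  \<open>z\<close> keeps the determinant, because \<open>z\<close> has coefficient 1 there. The new
  column has at most one nonzero entry, in row \<open>p0\<close>, and Laplace expansion along it
  leaves a single term.\<close>

lemma det_block_eq_pairing:
  assumes q0: "q0 < s" and p0: "p0 < s" and N: "c + s \<le> N + 1"
    and supp: "\<And>k. k \<notin> {c..<c + s} \<Longrightarrow> z k = 0"
    and one: "z (c + q0) = 1"
    and zero: "\<And>p. p < s \<Longrightarrow> p \<noteq> p0 \<Longrightarrow> pairing x N (r + p) z = 0"
  shows "det (block x r c s)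
       = pairing x N (r + p0) z * (-1) ^ (p0 + q0) * det (mat_delete (block x r c s) p0 q0)"
proof -
  let ?B = "block x r c s" and ?z = "vec s (\<lambda>q. z (c + q))"
  have Bz: "?B *\<^sub>v ?z = vec s (\<lambda>p. pairing x N (r + p) z)"
  proof (rule eq_vecI)
    fix p assume "p < dim_vec (vec s (\<lambda>p. pairing x N (r + p) z))"
    then have p: "p < s" by simp
    have "pairing x N (r + p) z = (\<Sum>k\<in>{c..<c + s}. x (r + p) k * z k)"
      unfolding pairing_def using N by (intro sum.mono_neutral_right) (auto simp: supp)
    also have "\<dots> = (\<Sum>q\<in>{0..<s}. x (r + p) (c + q) * z (c + q))"
      using sum.shift_bounds_nat_ivl[of "\<lambda>k. x (r + p) k * z k" 0 c s]
      by (simp add: add.commute)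
    finally show "(?B *\<^sub>v ?z) $ p = vec s (\<lambda>p. pairing x N (r + p) z) $ p"
      using p by (simp add: block_def scalar_prod_def)
  qed (simp add: block_def)
  let ?R = "replace_col ?B (?B *\<^sub>v ?z) q0"
  have R: "?R \<in> carrier_mat s s" by (simp add: replace_col_def block_def)
  have col: "?R $$ (p, q0) = (if p = p0 then pairing x N (r + p0) z else 0)" if "p < s" for p
    using that q0 zero unfolding replace_col_def Bz by (auto simp: block_def)
  have del: "mat_delete ?R p0 q0 = mat_delete ?B p0 q0"
    using p0 q0 by (intro eq_matI) (auto simp: mat_delete_def replace_col_def block_def)
  have "det ?B = det ?R"
    using cramer_lemma_mat[OF block_carrier, of ?z s q0 x r c] q0 one by simp
  also have "\<dots> = (\<Sum>p<s. ?R $$ (p, q0) * cofactor ?R p q0)"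
    by (rule laplace_expansion_column[OF R q0])
  also have "\<dots> = (\<Sum>p<s. if p = p0 then pairing x N (r + p0) z * cofactor ?R p0 q0 else 0)"
    by (intro sum.cong) (auto simp: col)
  also have "\<dots> = pairing x N (r + p0) z * cofactor ?R p0 q0"
    using p0 by simp
  finally show ?thesis by (simp add: cofactor_def del mult.assoc)
qed

text \<open>Meant for a backward residual \<open>z\<close>, whose norm thereby becomes a ratio of
  consecutive principal minors. The sign of the corner cofactor is even.\<close>

lemma det_block_drop_last:
  assumes "c + s \<le> N" and "\<And>k. k \<notin> {c..c + s} \<Longrightarrow> z k = 0" and "z (c + s) = 1"
    and "\<And>l. c \<le> l \<Longrightarrow> l < c + s \<Longrightarrow> pairing x N l z = 0"
  shows "det (block x c c (Suc s)) = pairing x N (c + s) z * det (block x c c s)"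
proof -
  have "mat_delete (block x c c (Suc s)) s s = block x c c s"
    by (intro eq_matI) (auto simp: mat_delete_def block_def)
  then show ?thesis
    using det_block_eq_pairing[of s "Suc s" s c N z x c] assms by (auto simp: less_Suc_eq_le simp flip: mult_2)
qed

lemma det_block_drop_first:
  assumes "c + s \<le> N" and "\<And>k. k \<notin> {c..c + s} \<Longrightarrow> z k = 0" and "z c = 1"
    and "\<And>l. c < l \<Longrightarrow> l \<le> c + s \<Longrightarrow> pairing x N l z = 0"
  shows "det (block x c c (Suc s)) = pairing x N c z * det (block x (Suc c) (Suc c) s)"
proof -
  have "mat_delete (block x c c (Suc s)) 0 0 = block x (Suc c) (Suc c) s"
    by (intro eq_matI) (auto simp: mat_delete_def block_def)
  then show ?thesis
    using det_block_eq_pairing[of 0 "Suc s" 0 c N z x c] assms by (auto simp: less_Suc_eq_le)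
qed

text \<open>The rows start one index before the columns, so the only row not orthogonal to
  \<open>z\<close> is the first one, while the coefficient 1 sits in the last column. The sign
  \<open>(-1) ^ s\<close> comes from this corner.\<close>

lemma det_block_shifted:
  assumes "Suc c + s \<le> N" and "\<And>k. k \<notin> {Suc c..Suc c + s} \<Longrightarrow> z k = 0" and "z (Suc c + s) = 1"
    and "\<And>l. Suc c \<le> l \<Longrightarrow> l < Suc c + s \<Longrightarrow> pairing x N l z = 0"
  shows "det (block x c (Suc c) (Suc s))
       = (-1) ^ s * pairing x N c z * det (block x (Suc c) (Suc c) s)"
proof -
  have "mat_delete (block x c (Suc c) (Suc s)) 0 s = block x (Suc c) (Suc c) s"
    by (intro eq_matI) (auto simp: mat_delete_def block_def)
  then show ?thesis
    using det_block_eq_pairing[of s "Suc s" 0 "Suc c" N z x c] assms by (auto simp: less_Suc_eq_le ac_simps)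
qed

text \<open>The residuals of the interval \<open>a..a + s\<close>, as coefficient functions. They are meaningful only if
  the divisors are nonzero, which \<open>nonsingular_intervals\<close> below guarantees.\<close>

fun fwd bwd :: "(nat \<Rightarrow> nat \<Rightarrow> 'a::field) \<Rightarrow> nat \<Rightarrow> nat \<Rightarrow> nat \<Rightarrow> nat \<Rightarrow> 'a" where
  "fwd x N a 0 = (\<lambda>k. if k = a then 1 else 0)"
| "bwd x N a 0 = (\<lambda>k. if k = a then 1 else 0)"
| "fwd x N a (Suc s) = (\<lambda>k. fwd x N a s k -
     pairing x N (Suc (a + s)) (fwd x N a s) / pairing x N (Suc (a + s)) (bwd x N (Suc a) s)
       * bwd x N (Suc a) s k)"
| "bwd x N a (Suc s) = (\<lambda>k. bwd x N (Suc a) s k -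
     pairing x N a (bwd x N (Suc a) s) / pairing x N a (fwd x N a s) * fwd x N a s k)"

lemma pairing_diff_scale:
  "pairing x N l (\<lambda>k. y k - t * z k) = pairing x N l y - t * pairing x N l z"
  by (simp add: pairing_def algebra_simps sum_subtractf sum_distrib_left)

lemma pairing_fwd_Suc:
  "pairing x N l (fwd x N a (Suc s)) = pairing x N l (fwd x N a s) -
     pairing x N (Suc (a + s)) (fwd x N a s) / pairing x N (Suc (a + s)) (bwd x N (Suc a) s)
       * pairing x N l (bwd x N (Suc a) s)"
  unfolding fwd.simps bwd.simps pairing_diff_scale ..

lemma pairing_bwd_Suc:
  "pairing x N l (bwd x N a (Suc s)) = pairing x N l (bwd x N (Suc a) s) -
     pairing x N a (bwd x N (Suc a) s) / pairing x N a (fwd x N a s) * pairing x N l (fwd x N a s)"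
  unfolding fwd.simps bwd.simps pairing_diff_scale ..

lemma fwd_bwd_support:
  shows "k \<notin> {a..a + s} \<Longrightarrow> fwd x N a s k = 0" and "k \<notin> {a..a + s} \<Longrightarrow> bwd x N a s k = 0"
  by (induction s arbitrary: a) auto

lemma fwd_first [simp]: "fwd x N a s a = 1"
  by (induction s) (auto simp: fwd_bwd_support)

lemma bwd_last: "bwd x N a s (a + s) = 1"
proof (induction s arbitrary: a)
  case (Suc s)
  show ?case using Suc[of "Suc a"] by (simp add: fwd_bwd_support)
qed simp

section \<open>Orthogonality and norms of the residuals\<close>

locale nonsingular_intervals =
  fixes x :: "nat \<Rightarrow> nat \<Rightarrow> 'a::field" and N lo hi :: nat
  assumes sym: "k \<le> N \<Longrightarrow> l \<le> N \<Longrightarrow> x k l = x l k"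
    and hi: "hi \<le> Suc N"
    and nonsing: "lo \<le> a \<Longrightarrow> a + s < hi \<Longrightarrow> det (block x a a (Suc s)) \<noteq> 0"
begin

lemma det_block_nonzero: "lo \<le> a \<Longrightarrow> a + s \<le> hi \<Longrightarrow> det (block x a a s) \<noteq> 0"
  using nonsing[of a "s - 1"] by (cases s) (auto simp: block_def)

text \<open>The forward residual projects onto \<open>a+1..a+s\<close> and the backward one onto
  \<open>a..a+s-1\<close>. Only these indices must lie in \<open>{lo..<hi}\<close>, so
  \<open>a\<close> may be one below \<open>lo\<close> in the first case and \<open>a + s\<close> may
  equal \<open>hi\<close> in the second. Each recursion step keeps the old orthogonality relations
  and its coefficient is chosen to produce the new one.\<close>

lemma residuals:
  shows "lo \<le> Suc a \<Longrightarrow> a + s < hi \<Longrightarrow> a < l \<Longrightarrow> l \<le> a + s \<Longrightarrow> pairing x N l (fwd x N a s) = 0"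
    and "lo \<le> a \<Longrightarrow> a + s \<le> hi \<Longrightarrow> a + s \<le> N \<Longrightarrow> a \<le> l \<Longrightarrow> l < a + s \<Longrightarrow> pairing x N l (bwd x N a s) = 0"
proof (induction s arbitrary: a l)
  case (Suc s)
  {
    case 1
    have b: "pairing x N m (bwd x N (Suc a) s) = 0" if "Suc a \<le> m" "m < Suc a + s" for m
      using Suc.IH(2)[of "Suc a" m] 1 that hi by simp
    \<comment> \<open>The divisor is a factor of a nonzero principal minor.\<close>
    have "pairing x N (Suc a + s) (bwd x N (Suc a) s) \<noteq> 0"
      using det_block_drop_last[of "Suc a" s N "bwd x N (Suc a) s" x] b
        det_block_nonzero[of "Suc a" "Suc s"] 1 hi fwd_bwd_support(2)[of _ "Suc a" s] bwd_last[of x N "Suc a" s]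
      by force
    then show ?case using b[of l] Suc.IH(1)[of a l] 1
      unfolding pairing_fwd_Suc by (cases "l = Suc (a + s)") auto
  next
    case 2
    have f: "pairing x N m (fwd x N a s) = 0" if "a < m" "m \<le> a + s" for m
      using Suc.IH(1)[of a m] 2 that by simp
    have "pairing x N a (fwd x N a s) \<noteq> 0"
      using det_block_drop_first[of a s N "fwd x N a s" x] f
        det_block_nonzero[of a "Suc s"] 2 fwd_bwd_support(1)[of _ a s]
      by force
    then show ?case using f[of l] Suc.IH(2)[of "Suc a" l] 2
      unfolding pairing_bwd_Suc by (cases "l = a") auto
  }
qed auto

text \<open>Both sides are the value of the symmetric form at the two residuals. Each residual is
  orthogonal to all basis vectors in the support of the other except one, whose coefficient is
  1.\<close>

lemma pairing_fwd_bwd_commute: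
  assumes "lo \<le> Suc a" and "a + s < hi" and "Suc (a + s) \<le> N"
  shows "pairing x N (Suc (a + s)) (fwd x N a s) = pairing x N a (bwd x N (Suc a) s)"
proof -
  let ?f = "fwd x N a s" and ?b = "bwd x N (Suc a) s"
  have f: "?b l * pairing x N l ?f = 0" if "l \<noteq> Suc (a + s)" for l
    using residuals(1)[of a s l] fwd_bwd_support(2)[of l "Suc a" s x N] assms that by force
  have b: "?f l * pairing x N l ?b = 0" if "l \<noteq> a" for l
    using residuals(2)[of "Suc a" s l] fwd_bwd_support(1)[of l a s x N] assms that by force
  have "pairing x N (Suc (a + s)) ?f = ?b (Suc (a + s)) * pairing x N (Suc (a + s)) ?f"
    using bwd_last[of x N "Suc a" s] by simp
  also have "\<dots> = (\<Sum>l\<le>N. ?b l * pairing x N l ?f)"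
    using assms(3) by (subst sum.remove[of _ "Suc (a + s)"]) (auto simp: f)
  also have "\<dots> = (\<Sum>l\<le>N. \<Sum>k\<le>N. ?b l * x l k * ?f k)"
    by (simp add: pairing_def sum_distrib_left mult.assoc)
  also have "\<dots> = (\<Sum>k\<le>N. \<Sum>l\<le>N. ?b l * x l k * ?f k)"
    by (rule sum.swap)
  also have "\<dots> = (\<Sum>k\<le>N. ?f k * pairing x N k ?b)"
    using sym by (intro sum.cong refl) (simp add: pairing_def sum_distrib_left mult.assoc mult.left_commute mult.commute)
  also have "\<dots> = pairing x N a ?b"
    using assms(3) by (subst sum.remove[of _ a]) (auto simp: b)
  finally show ?thesis .
qed

lemma det_bwd:
  assumes "lo \<le> a" "a + s \<le> hi" "a + s \<le> N"
  shows "det (block x a a (Suc s)) = pairing x N (a + s) (bwd x N a s) * det (block x a a s)"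
  using det_block_drop_last[of a s N "bwd x N a s" x] residuals(2)[of a s] assms
    fwd_bwd_support(2)[of _ a s] bwd_last[of x N a s] by blast

lemma det_fwd:
  assumes "lo \<le> Suc a" "a + s < hi" "a + s \<le> N"
  shows "det (block x a a (Suc s)) = pairing x N a (fwd x N a s) * det (block x (Suc a) (Suc a) s)"
  using det_block_drop_first[of a s N "fwd x N a s" x] residuals(1)[of a s] assms
    fwd_bwd_support(1)[of _ a s] fwd_first[of x N a s] by blast

lemma det_cross:
  assumes "lo \<le> Suc a" "Suc a + s \<le> hi" "Suc a + s \<le> N"
  shows "det (block x a (Suc a) (Suc s))
       = (-1) ^ s * pairing x N a (bwd x N (Suc a) s) * det (block x (Suc a) (Suc a) s)"
  using det_block_shifted[of a s N "bwd x N (Suc a) s" x] residuals(2)[of "Suc a" s] assms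
    fwd_bwd_support(2)[of _ "Suc a" s] bwd_last[of x N "Suc a" s] by blast

lemma fwd_norm_nonzero: "lo \<le> a \<Longrightarrow> a + s < hi \<Longrightarrow> a + s \<le> N \<Longrightarrow> pairing x N a (fwd x N a s) \<noteq> 0"
  using det_fwd[of a s] det_block_nonzero[of a "Suc s"] by auto

lemma bwd_norm_nonzero:
  "lo \<le> a \<Longrightarrow> a + s < hi \<Longrightarrow> a + s \<le> N \<Longrightarrow> pairing x N (a + s) (bwd x N a s) \<noteq> 0"
  using det_bwd[of a s] det_block_nonzero[of a "Suc s"] by auto

text \<open>The quotient is the coefficient of \<open>e\<^sub>a\<close> in the projection of
  \<open>e\<^sub>l\<close> onto the span of the interval. The correction term describes how it
  changes when the next basis vector is adjoined; its last factor is, up to sign, the weight of a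
  local minimum.\<close>

lemma fwd_coefficient_step:
  assumes "lo \<le> a" and "Suc (a + s) < hi" and "Suc (a + s) \<le> N"
  shows "pairing x N l (fwd x N a (Suc s)) / pairing x N a (fwd x N a (Suc s))
       = pairing x N l (fwd x N a s) / pairing x N a (fwd x N a s)
       - pairing x N l (bwd x N a (Suc s)) * (pairing x N a (bwd x N (Suc a) s) /
           (pairing x N (Suc (a + s)) (bwd x N (Suc a) s) * pairing x N a (fwd x N a (Suc s))))"
proof -
  define F where "F = pairing x N l (fwd x N a s)"
  define G where "G = pairing x N l (bwd x N (Suc a) s)"
  define c where "c = pairing x N a (bwd x N (Suc a) s)"
  define \<sigma> where "\<sigma> = pairing x N a (fwd x N a s)"
  define \<beta> where "\<beta> = pairing x N (Suc (a + s)) (bwd x N (Suc a) s)"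
  define \<sigma>' where "\<sigma>' = pairing x N a (fwd x N a (Suc s))"
  have comm: "pairing x N (Suc (a + s)) (fwd x N a s) = c"
    unfolding c_def using assms by (intro pairing_fwd_bwd_commute) auto
  have nz: "\<sigma> \<noteq> 0" "\<beta> \<noteq> 0" "\<sigma>' \<noteq> 0"
    using fwd_norm_nonzero[of a s] bwd_norm_nonzero[of "Suc a" s] fwd_norm_nonzero[of a "Suc s"] assms
    by (simp_all add: \<sigma>_def \<beta>_def \<sigma>'_def del: fwd.simps bwd.simps)
  have e: "\<sigma>' = \<sigma> - c / \<beta> * c"
    unfolding \<sigma>'_def pairing_fwd_Suc comm by (simp add: \<sigma>_def \<beta>_def c_def)
  \<comment> \<open>Both sides are the Gram determinant of the forward and backward residuals; with
    it the claim becomes a polynomial identity.\<close>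
  have h: "\<beta> * \<sigma>' = \<sigma> * \<beta> - c * c" using nz by (simp add: e field_simps)
  have "(F * \<beta> - c * G) * \<sigma> = F * (\<beta> * \<sigma>') - (G * \<sigma> - c * F) * c"
    unfolding h by (simp add: algebra_simps)
  then have "(F - c / \<beta> * G) / \<sigma>' = F / \<sigma> - (G - c / \<sigma> * F) * (c / (\<beta> * \<sigma>'))"
    using nz by (simp add: divide_simps)
  then show ?thesis
    unfolding pairing_fwd_Suc[of x N l] pairing_bwd_Suc[of x N l] comm
    by (simp only: F_def G_def c_def \<sigma>_def \<beta>_def \<sigma>'_def)
qed

end

section \<open>Labels and weights along a path\<close>

text \<open>Vertices are addressed by their left and right index: an up step raises the right index
  by 1, a down step the left one.\<close>

definition pt :: "nat \<Rightarrow> nat \<Rightarrow> point" where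
  "pt a b = (int a + int b - 2, int b - int a)"

lemma pt_simps [simp]:
  "fst (pt a b) = int a + int b - 2" "snd (pt a b) = int b - int a"
  "left_index (pt a b) = a" "right_index (pt a b) = b"
  by (simp_all add: pt_def left_index_def right_index_def)

lemma pt_eq_iff [simp]: "pt a b = pt c d \<longleftrightarrow> a = c \<and> b = d"
  by (auto simp: pt_def)

lemma node_eq_pt: "node k = pt k k"
  by (simp add: node_def pt_def)

lemma two_above_pt: "two_above (pt (Suc a) b) = pt a (Suc b)"
  by (simp add: two_above_def pt_def)

lemma steps_iff:
  "(u, v) \<in> steps \<longleftrightarrow> fst v = fst u + 1 \<and> (snd v = snd u + 1 \<or> snd v = snd u - 1)"
  by (auto simp: steps_def split: prod.splits)

lemma inner_indices_pt: "inner_indices (pt a (Suc (a + s))) = {Suc a..<Suc (a + s)}"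
  by (auto simp: inner_indices_def)

lemma P_label_pt:
  assumes "X \<in> carrier_mat n n" "a + s \<le> n"
  shows "P_label X (pt a (Suc (a + s)))
       = (-1) ^ (s div 2) * det (block (\<lambda>k l. X $$ (k - 1, l - 1)) (Suc a) (Suc a) s)"
  using assms minor_interval[of X n "Suc a" "Suc a" s]
  by (simp add: P_label_def p_minor_def inner_indices_pt)

lemma A_label_pt:
  assumes "X \<in> carrier_mat n n" "1 \<le> a" "Suc a + s \<le> n"
  shows "A_label X (pt a (Suc (a + s)))
       = (-1) ^ (Suc s div 2) * det (block (\<lambda>k l. X $$ (k - 1, l - 1)) a (Suc a) (Suc s))"
proof -
  have "{a} \<union> {Suc a..<Suc (a + s)} = {a..<a + Suc s}"
    "{Suc (a + s)} \<union> {Suc a..<Suc (a + s)} = {Suc a..<Suc a + Suc s}" by auto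
  then show ?thesis
    using assms minor_interval[of X n a "Suc a" "Suc s"]
    by (simp add: A_label_def a_minor_def inner_indices_pt)
qed

lemma A_div_P_label:
  assumes "nonsingular_intervals (\<lambda>k l. X $$ (k - 1, l - 1)) n lo hi"
    and X: "X \<in> carrier_mat n n" and a: "1 \<le> a" "lo \<le> Suc a" "Suc (a + s) \<le> hi" "Suc (a + s) \<le> n"
  shows "A_label X (pt a (Suc (a + s))) / P_label X (pt a (Suc (a + s)))
       = pairing (\<lambda>k l. X $$ (k - 1, l - 1)) n a (bwd (\<lambda>k l. X $$ (k - 1, l - 1)) n (Suc a) s)"
proof -
  interpret nonsingular_intervals "\<lambda>k l. X $$ (k - 1, l - 1)" n lo hi by fact
  \<comment> \<open>The ceiling sign of the label \<open>a\<close> and the corner sign of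
    \<open>det_cross\<close> combine to the floor sign of the label \<open>p\<close>.\<close>
  have "(- 1 :: 'a) ^ (Suc s div 2) * (- 1) ^ s = (- 1) ^ (s div 2)"
    by (cases "even s") (auto elim!: evenE oddE simp flip: power_add)
  then show ?thesis
    using A_label_pt[OF X, of a s] P_label_pt[OF X, of a s] det_cross[of a s]
      det_block_nonzero[of "Suc a" s] a
    by (simp add: mult.assoc[symmetric])
qed

text \<open>The region above has the inner indices \<open>a..a+s+1\<close>, two more than the
  vertex, which flips the floor sign and causes the minus. Its minor splits into a forward norm, a
  backward norm and the minor of \<open>a+1..a+s\<close>, and the last one cancels against
  \<open>det_cross\<close>.\<close>

lemma A_div_P_label_above:
  assumes "nonsingular_intervals (\<lambda>k l. X $$ (k - 1, l - 1)) n lo hi"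
    and X: "X \<in> carrier_mat n n" and a: "1 < a" "lo \<le> a" "Suc (a + s) < hi" "Suc (a + s) \<le> n"
  defines "x \<equiv> \<lambda>k l. X $$ (k - 1, l - 1)"
  shows "A_label X (pt a (Suc (a + s))) / P_label X (two_above (pt a (Suc (a + s))))
       = - (pairing x n a (bwd x n (Suc a) s) /
           (pairing x n (Suc (a + s)) (bwd x n (Suc a) s) * pairing x n a (fwd x n a (Suc s))))"
proof -
  interpret nonsingular_intervals x n lo hi unfolding x_def by fact
  obtain a' where a': "a = Suc a'" using a(1) by (cases a) auto
  have P: "P_label X (two_above (pt a (Suc (a + s)))) = (-1) ^ Suc (s div 2) * det (block x a a (Suc (Suc s)))"
    using P_label_pt[OF X, of a' "Suc (Suc s)"] a by (simp add: a' two_above_pt x_def)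
  have A: "A_label X (pt a (Suc (a + s))) = (-1) ^ (Suc s div 2) * det (block x a (Suc a) (Suc s))"
    using A_label_pt[OF X, of a s] a by (simp add: x_def)
  have sgn: "(- 1 :: 'a) ^ (Suc s div 2) * (- 1) ^ s = (- 1) ^ (s div 2)"
    by (cases "even s") (auto elim!: evenE oddE simp flip: power_add)
  have m: "det (block x a (Suc a) (Suc s))
      = (-1) ^ s * pairing x n a (bwd x n (Suc a) s) * det (block x (Suc a) (Suc a) s)"
    using det_cross[of a s] a by simp
  have d: "det (block x a a (Suc (Suc s))) = pairing x n a (fwd x n a (Suc s)) *
      (pairing x n (Suc (a + s)) (bwd x n (Suc a) s) * det (block x (Suc a) (Suc a) s))"
    using det_fwd[of a "Suc s"] det_bwd[of "Suc a" s] a by (simp del: fwd.simps bwd.simps)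
  show ?thesis
    using det_block_nonzero[of "Suc a" s] a unfolding A P m d
    by (simp add: sgn mult.assoc[symmetric] del: fwd.simps bwd.simps)
qed

section \<open>Weights of paths extended by one step\<close>

definition turn_weight :: "'a::field mat \<Rightarrow> point \<Rightarrow> point \<Rightarrow> point \<Rightarrow> 'a" where
  "turn_weight X u v w =
     (if snd u < snd v \<and> snd w < snd v then A_label X v / P_label X v
      else if snd v < snd u \<and> snd v < snd w
      then (if 1 \<le> snd v then A_label X v else 1) / P_label X (two_above v)
      else 1)"

lemma local_max_snoc:
  "local_max (C @ [u, v, w]) = local_max (C @ [u, v]) \<union>
     (if snd u < snd v \<and> snd w < snd v then {Suc (length C)} else {})"
  by (auto simp: local_max_def nth_append less_Suc_eq nth_Cons' split: if_splits)

lemma local_min_snoc: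
  "local_min (C @ [u, v, w]) = local_min (C @ [u, v]) \<union>
     (if snd v < snd u \<and> snd v < snd w then {Suc (length C)} else {})"
  by (auto simp: local_min_def nth_append less_Suc_eq nth_Cons' split: if_splits)

lemma local_extrema_less_length:
  "k \<in> local_max C \<Longrightarrow> Suc k < length C" "k \<in> local_min C \<Longrightarrow> Suc k < length C"
  by (auto simp: local_max_def local_min_def)

lemma finite_local_extrema [simp]: "finite (local_max C)" "finite (local_min C)"
  by (rule finite_subset[of _ "{..<length C}"]; auto dest: local_extrema_less_length)+

text \<open>Endpoints are never local extrema, so appending \<open>w\<close> only decides the status
  of \<open>v\<close>.\<close>

lemma path_weight_snoc:
  "path_weight X (C @ [u, v, w]) = path_weight X (C @ [u, v]) * turn_weight X u v w"
proof -
  let ?L = "C @ [u, v]" and ?L' = "C @ [u, v, w]" and ?t = "Suc (length C)"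
  have nth: "?L' ! k = ?L ! k" if "k < length ?L" for k
    using nth_append[of ?L "[w]" k] that by simp
  have t: "?L' ! ?t = v" "?t \<notin> local_max ?L" "?t \<notin> local_min ?L"
    by (auto simp: nth_append dest: local_extrema_less_length)
  have old: "(\<Prod>k\<in>local_max ?L. A_label X (?L' ! k) / P_label X (?L' ! k))
        = (\<Prod>k\<in>local_max ?L. A_label X (?L ! k) / P_label X (?L ! k))"
    "(\<Prod>k\<in>{k \<in> local_min ?L. 1 \<le> snd (?L' ! k)}. A_label X (?L' ! k))
        = (\<Prod>k\<in>{k \<in> local_min ?L. 1 \<le> snd (?L ! k)}. A_label X (?L ! k))"
    "(\<Prod>k\<in>local_min ?L. P_label X (two_above (?L' ! k)))
        = (\<Prod>k\<in>local_min ?L. P_label X (two_above (?L ! k)))"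
    by (auto intro!: prod.cong simp: nth dest: local_extrema_less_length)
  have split: "{k \<in> insert ?t (local_min ?L). 1 \<le> snd (?L' ! k)} =
      (if 1 \<le> snd v then insert ?t {k \<in> local_min ?L. 1 \<le> snd (?L' ! k)}
       else {k \<in> local_min ?L. 1 \<le> snd (?L' ! k)})"
    using t(1) by auto
  consider "snd u < snd v" "snd w < snd v" | "snd v < snd u" "snd v < snd w"
    | "\<not> (snd u < snd v \<and> snd w < snd v)" "\<not> (snd v < snd u \<and> snd v < snd w)" by blast
  then show ?thesis
  proof cases
    case 1
    then show ?thesis
      using t old by (simp add: path_weight_def local_max_snoc local_min_snoc turn_weight_def mult_ac)
  next
    case 2
    then have M: "local_max ?L' = local_max ?L" "local_min ?L' = insert ?t (local_min ?L)"
      by (auto simp: local_max_snoc local_min_snoc)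
    show ?thesis
      using t old 2 unfolding path_weight_def M split turn_weight_def
      by (simp add: mult_ac)
  next
    case 3
    then have M: "local_max ?L' = local_max ?L" "local_min ?L' = local_min ?L"
      by (auto simp: local_max_snoc local_min_snoc)
    show ?thesis unfolding path_weight_def M old using 3 by (auto simp: turn_weight_def)
  qed
qed

lemma path_weight_pair: "path_weight X [u, v] = 1"
proof -
  have "local_max [u, v] = {}" "local_min [u, v] = {}"
    by (auto dest: local_extrema_less_length simp: local_max_def local_min_def)
  then show ?thesis by (simp add: path_weight_def)
qed

section \<open>Sums over partial paths\<close>

text \<open>Any end vertex is allowed, so that nonempty prefixes of walks are again walks, and
  \<open>successively\<close> splits well at the last step.\<close>

definition walks :: "nat \<Rightarrow> point \<Rightarrow> point list set" where
  "walks i v = {C. C \<noteq> [] \<and> hd C = node i \<and> last C = v \<and>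
     successively (\<lambda>u w. (u, w) \<in> steps) C \<and> (\<forall>w \<in> set C. 0 \<le> snd w)}"

lemma catalan_path_iff_walk: "catalan_path i j C \<longleftrightarrow> C \<in> walks i (node j)"
  by (auto simp: catalan_path_def walks_def successively_conv_nth)

lemma snoc_mem_walks_iff:
  "C @ [v] \<in> walks i w \<longleftrightarrow> v = w \<and> 0 \<le> snd v \<and>
     (if C = [] then v = node i else C \<in> walks i (last C) \<and> (last C, v) \<in> steps)"
  by (auto simp: walks_def successively_append_iff)

text \<open>Each step raises one of \<open>x - y\<close> and \<open>x + y\<close> by 2 and fixes the
  other, so both are monotone along a walk and the parity of \<open>x + y\<close> is
  preserved.\<close>

lemma walks_bounds:
  "C \<in> walks i v \<Longrightarrow> w \<in> set C \<Longrightarrow>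
     2 * int i - 2 \<le> fst w - snd w \<and> fst w + snd w \<le> fst v + snd v \<and> even (fst w + snd w)"
proof (induction C arbitrary: v w rule: rev_induct)
  case Nil
  then show ?case by simp
next
  case (snoc u C)
  show ?case
  proof (cases "C = []")
    case True
    then show ?thesis using snoc.prems by (auto simp: snoc_mem_walks_iff[of "[]", simplified] node_def)
  next
    case False
    let ?l = "last C"
    have l: "C \<in> walks i ?l" "(?l, v) \<in> steps" "u = v"
      using snoc.prems False by (auto simp: snoc_mem_walks_iff)
    have b: "2 * int i - 2 \<le> fst w' - snd w' \<and> fst w' + snd w' \<le> fst ?l + snd ?l \<and> even (fst w' + snd w')"
      if "w' \<in> set C" for w' using snoc.IH[OF l(1) that] .
    have s: "fst ?l - snd ?l \<le> fst v - snd v" "fst ?l + snd ?l \<le> fst v + snd v"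
      "fst v + snd v = fst ?l + snd ?l + 2 \<or> fst v + snd v = fst ?l + snd ?l"
      using l(2) by (auto simp: steps_iff)
    show ?thesis
    proof (cases "w = v")
      case True
      have l: "2 * int i - 2 \<le> fst ?l - snd ?l" "even (fst ?l + snd ?l)"
        using b[of ?l] False by auto
      moreover have "even (fst v + snd v)" using s(3) l(2) by presburger
      ultimately show ?thesis using s unfolding True by linarith
    next
      case neq: False
      then have "w \<in> set C" using snoc.prems(2) l(3) by auto
      then show ?thesis using b[of w] s by auto
    qed
  qed
qed

text \<open>The monotone quantities confine every walk between the two nodes to the triangle of
  \<open>G_verts n\<close>.\<close>

lemma catalan_paths_eq_walks:
  assumes "1 \<le> i" "j \<le> n"
  shows "catalan_paths n i j = walks i (node j)"
proof -
  have "path_in_G n C" if C: "C \<in> walks i (node j)" for C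
  proof -
    have V: "set C \<subseteq> G_verts n"
    proof
      fix w assume w: "w \<in> set C"
      have "0 \<le> snd w" using C w by (simp add: walks_def)
      then show "w \<in> G_verts n"
        using walks_bounds[OF C w] assms by (auto simp: G_verts_def node_def split: prod.splits)
    qed
    then show ?thesis using C
      by (auto simp: path_in_G_def G_edges_def walks_def successively_conv_nth)
  qed
  then show ?thesis by (auto simp: catalan_paths_def catalan_path_iff_walk)
qed

text \<open>The arguments \<open>a b\<close> of \<open>ups\<close>, \<open>downs\<close> and their sums describe the last but one vertex.\<close>

definition ups :: "nat \<Rightarrow> nat \<Rightarrow> nat \<Rightarrow> point list set" where
  "ups i a b = (\<lambda>C. C @ [pt a (Suc b)]) ` walks i (pt a b)"

definition downs :: "nat \<Rightarrow> nat \<Rightarrow> nat \<Rightarrow> point list set" where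
  "downs i a b = (\<lambda>C. C @ [pt (Suc a) b]) ` walks i (pt a b)"

lemma walks_empty: "a < i \<Longrightarrow> walks i (pt a b) = {}"
proof (rule ccontr)
  assume "a < i" "walks i (pt a b) \<noteq> {}"
  then obtain C where C: "C \<in> walks i (pt a b)" by auto
  then have "pt a b \<in> set C" using last_in_set by (force simp: walks_def)
  then show False using walks_bounds[OF C, of "pt a b"] \<open>a < i\<close> by simp
qed

lemma walks_snocI: "C \<in> walks i u \<Longrightarrow> (u, v) \<in> steps \<Longrightarrow> 0 \<le> snd v \<Longrightarrow> C @ [v] \<in> walks i v"
  by (auto simp: walks_def successively_append_iff)

lemma walks_cases:
  assumes "C \<in> walks i v"
  obtains "C = [v]" "v = node i"
  | C' u where "C = C' @ [v]" "C' \<in> walks i u" "(u, v) \<in> steps" "0 \<le> snd u"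
proof (cases C rule: rev_cases)
  case Nil
  then show ?thesis using assms by (simp add: walks_def)
next
  case (snoc C' w)
  then have w: "w = v" "if C' = [] then w = node i else C' \<in> walks i (last C') \<and> (last C', w) \<in> steps"
    using assms by (auto simp: snoc_mem_walks_iff split: if_splits)
  show ?thesis
  proof (cases "C' = []")
    case True
    then show ?thesis using that(1) snoc w by simp
  next
    case False
    then have C': "C' \<in> walks i (last C')" "(last C', v) \<in> steps" using w by simp_all
    then have "0 \<le> snd (last C')" using False by (simp add: walks_def)
    then show ?thesis using that(2)[of C' "last C'"] C' snoc w(1) by simp
  qed
qed

lemma step_into_pt: "(u, pt (Suc a) (Suc b)) \<in> steps \<Longrightarrow> u = pt a (Suc b) \<or> u = pt (Suc a) b"
  by (auto simp: steps_iff pt_def prod_eq_iff)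

lemma steps_pt: "(pt a b, pt a (Suc b)) \<in> steps" "(pt a b, pt (Suc a) b) \<in> steps"
  by (simp_all add: steps_iff)

lemma downs_subset: "a < b \<Longrightarrow> downs i a b \<subseteq> walks i (pt (Suc a) b)"
  unfolding downs_def by (auto intro!: walks_snocI steps_pt)

lemma ups_subset: "a \<le> b \<Longrightarrow> ups i a b \<subseteq> walks i (pt a (Suc b))"
  unfolding ups_def by (auto intro!: walks_snocI steps_pt)

lemma walks_axis: "walks i (pt (Suc a) (Suc a)) = (if Suc a = i then {[node i]} else {}) \<union> downs i a (Suc a)"
proof (rule equalityI; rule subsetI)
  fix C assume "C \<in> walks i (pt (Suc a) (Suc a))"
  then show "C \<in> (if Suc a = i then {[node i]} else {}) \<union> downs i a (Suc a)"
  proof (cases rule: walks_cases)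
    case 1
    then show ?thesis by (simp add: node_eq_pt)
  next
    case (2 C' u)
    \<comment> \<open>The other predecessor, \<open>pt (Suc a) a\<close>, lies below the
      axis.\<close>
    then have "u = pt a (Suc a)" using step_into_pt[OF 2(3)] by auto
    then show ?thesis using 2 by (simp add: downs_def)
  qed
next
  fix C assume C: "C \<in> (if Suc a = i then {[node i]} else {}) \<union> downs i a (Suc a)"
  have "[node i] \<in> walks i (node i)" by (simp add: walks_def node_eq_pt)
  then show "C \<in> walks i (pt (Suc a) (Suc a))"
    using C downs_subset[of a "Suc a" i] by (auto simp: node_eq_pt split: if_splits)
qed

lemma walks_interior:
  assumes "a < b"
  shows "walks i (pt (Suc a) (Suc b)) = ups i (Suc a) b \<union> downs i a (Suc b)"
proof (rule equalityI; rule subsetI)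
  fix C assume "C \<in> walks i (pt (Suc a) (Suc b))"
  then show "C \<in> ups i (Suc a) b \<union> downs i a (Suc b)"
  proof (cases rule: walks_cases)
    case 1
    then show ?thesis using assms by (simp add: node_eq_pt)
  next
    case (2 C' u)
    then show ?thesis using step_into_pt[OF 2(3)] by (auto simp: downs_def ups_def)
  qed
next
  fix C assume "C \<in> ups i (Suc a) b \<union> downs i a (Suc b)"
  then show "C \<in> walks i (pt (Suc a) (Suc b))"
    using downs_subset[of a "Suc b" i] ups_subset[of "Suc a" b i] assms by auto
qed

lemma finite_walks: "1 \<le> i \<Longrightarrow> finite (walks i (pt a b))"
\<comment> \<open>Every step raises the sum of the two indices by 1.\<close>
proof (induction "a + b" arbitrary: a b rule: less_induct)
  case less
  show ?case
  proof (cases "a < i")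
    case True
    then show ?thesis by (simp add: walks_empty)
  next
    case False
    then obtain a' where a: "a = Suc a'" using less.prems by (cases a) auto
    consider "b < a" | "b = a" | "a < b" by linarith
    then show ?thesis
    proof cases
      case 1
      then have "walks i (pt a b) = {}" using last_in_set by (force simp: walks_def)
      then show ?thesis by simp
    next
      case 2
      then show ?thesis using less.hyps[of a' b] less.prems by (simp add: a walks_axis downs_def)
    next
      case 3
      then obtain b' where "b = Suc b'" "a' < b'" using a by (cases b) auto
      then show ?thesis using less.hyps[of a' b] less.hyps[of a b'] less.prems
        by (simp add: a walks_interior downs_def ups_def)
    qed
  qed
qed

lemma finite_ups: "1 \<le> i \<Longrightarrow> finite (ups i a b)"
  and finite_downs: "1 \<le> i \<Longrightarrow> finite (downs i a b)"
  by (simp_all add: ups_def downs_def finite_walks)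

lemma ups_downs_disjoint: "ups i (Suc a) b \<inter> downs i a (Suc b) = {}"
proof -
  have "last (butlast C) = pt (Suc a) b" if "C \<in> ups i (Suc a) b" for C
    using that by (auto simp: ups_def walks_def)
  moreover have "last (butlast C) = pt a (Suc b)" if "C \<in> downs i a (Suc b)" for C
    using that by (auto simp: downs_def walks_def)
  ultimately show ?thesis by fastforce
qed

lemma walk_snocE:
  assumes "C \<in> walks i v" obtains C' where "C = C' @ [v]"
proof -
  have "C \<noteq> []" "last C = v" using assms by (simp_all add: walks_def)
  then have "C = butlast C @ [v]" using append_butlast_last_id[of C] by simp
  then show ?thesis by (rule that)
qed

lemma path_weight_ups_snoc:
  assumes "C \<in> ups i a b"
  shows "path_weight X (C @ [w]) = path_weight X C * turn_weight X (pt a b) (pt a (Suc b)) w"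
proof -
  obtain C0 where C0: "C0 \<in> walks i (pt a b)" "C = C0 @ [pt a (Suc b)]"
    using assms by (auto simp: ups_def)
  obtain C1 where "C0 = C1 @ [pt a b]" using C0(1) by (rule walk_snocE)
  then show ?thesis using path_weight_snoc[of X C1 "pt a b" "pt a (Suc b)" w] C0(2) by simp
qed

lemma path_weight_downs_snoc:
  assumes "C \<in> downs i a b"
  shows "path_weight X (C @ [w]) = path_weight X C * turn_weight X (pt a b) (pt (Suc a) b) w"
proof -
  obtain C0 where C0: "C0 \<in> walks i (pt a b)" "C = C0 @ [pt (Suc a) b]"
    using assms by (auto simp: downs_def)
  obtain C1 where "C0 = C1 @ [pt a b]" using C0(1) by (rule walk_snocE)
  then show ?thesis using path_weight_snoc[of X C1 "pt a b" "pt (Suc a) b" w] C0(2) by simp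
qed

section \<open>Recursions for the weight sums\<close>

definition up_sum :: "'a::field mat \<Rightarrow> nat \<Rightarrow> nat \<Rightarrow> nat \<Rightarrow> 'a" where
  "up_sum X i a b = (\<Sum>C\<in>ups i a b. path_weight X C)"

definition down_sum :: "'a::field mat \<Rightarrow> nat \<Rightarrow> nat \<Rightarrow> nat \<Rightarrow> 'a" where
  "down_sum X i a b = (\<Sum>C\<in>downs i a b. path_weight X C)"

lemma sum_walks_interior_snoc:
  assumes "1 \<le> i" "a < b"
  shows "(\<Sum>C\<in>walks i (pt (Suc a) (Suc b)). path_weight X (C @ [w]))
       = up_sum X i (Suc a) b * turn_weight X (pt (Suc a) b) (pt (Suc a) (Suc b)) w
       + down_sum X i a (Suc b) * turn_weight X (pt a (Suc b)) (pt (Suc a) (Suc b)) w"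
  using assms
  by (simp add: walks_interior sum.union_disjoint finite_ups finite_downs ups_downs_disjoint
      path_weight_ups_snoc path_weight_downs_snoc up_sum_def down_sum_def sum_distrib_right)

lemma up_sum_eq: "up_sum X i a b = (\<Sum>C\<in>walks i (pt a b). path_weight X (C @ [pt a (Suc b)]))"
  unfolding up_sum_def ups_def by (subst sum.reindex) (auto simp: inj_on_def)

lemma down_sum_eq: "down_sum X i a b = (\<Sum>C\<in>walks i (pt a b). path_weight X (C @ [pt (Suc a) b]))"
  unfolding down_sum_def downs_def by (subst sum.reindex) (auto simp: inj_on_def)

text \<open>Going up after an up step creates no extremum; going up after a down step creates a
  local minimum, which \<open>a < b\<close> places above the axis.\<close>

lemma up_sum_Suc:
  assumes "1 \<le> i" "a < b"
  shows "up_sum X i (Suc a) (Suc b) = up_sum X i (Suc a) b + down_sum X i a (Suc b) *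
    (A_label X (pt (Suc a) (Suc b)) / P_label X (two_above (pt (Suc a) (Suc b))))"
  using assms by (simp add: up_sum_eq[of X i "Suc a" "Suc b"] sum_walks_interior_snoc turn_weight_def)

lemma down_sum_Suc:
  assumes "1 \<le> i" "a < b"
  shows "down_sum X i (Suc a) (Suc b) = down_sum X i a (Suc b) + up_sum X i (Suc a) b *
    (A_label X (pt (Suc a) (Suc b)) / P_label X (pt (Suc a) (Suc b)))"
  using assms by (simp add: down_sum_eq[of X i "Suc a" "Suc b"] sum_walks_interior_snoc turn_weight_def)

lemma down_sum_left: "a < i \<Longrightarrow> down_sum X i a b = 0"
  by (simp add: down_sum_eq walks_empty)

lemma up_sum_axis_start:
  assumes "1 \<le> i" shows "up_sum X i i i = 1"
proof -
  obtain i' where i': "i = Suc i'" using assms by (cases i) auto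
  have "walks i (pt i i) = {[pt i i]}"
    by (simp add: i' walks_axis downs_def walks_empty node_eq_pt)
  then show ?thesis by (simp add: up_sum_eq path_weight_pair)
qed

lemma up_sum_axis:
  assumes "1 \<le> i" "i \<le> a"
  shows "up_sum X i (Suc a) (Suc a) = down_sum X i a (Suc a) / P_label X (two_above (pt (Suc a) (Suc a)))"
  using assms
  by (simp add: up_sum_eq walks_axis path_weight_downs_snoc turn_weight_def down_sum_def sum_divide_distrib)

lemma sum_walks_node:
  assumes "i \<le> a"
  shows "(\<Sum>C\<in>walks i (node (Suc a)). path_weight X C) = down_sum X i a (Suc a)"
  using assms by (simp add: node_eq_pt walks_axis down_sum_def)

text \<open>A walk whose left index is still \<open>i\<close> has never descended: it is the
  straight ascent, without extrema.\<close>

lemma up_sum_start: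
  assumes "1 \<le> i" shows "up_sum X i i (i + s) = 1"
proof (induction s)
  case 0
  show ?case using up_sum_axis_start[OF assms] by simp
next
  case (Suc s)
  obtain i' where i': "i = Suc i'" using assms by (cases i) auto
  have "up_sum X i i (Suc (i + s)) = up_sum X i i (i + s)"
    using up_sum_Suc[OF assms, of i' "i + s" X] by (simp add: i' down_sum_left)
  then show ?case using Suc by simp
qed

text \<open>Induction on the left index, with \<open>s\<close> arbitrary since the up sums at the
  next left index consume down sums for all larger right indices. The backward residual is that of
  the interval labelling the vertex reached by the final down step.\<close>

lemma walk_sums:
  assumes I: "nonsingular_intervals (\<lambda>k l. X $$ (k - 1, l - 1)) n (Suc i) j"
    and X: "X \<in> carrier_mat n n" and i: "1 \<le> i" and j: "j \<le> n"
  defines "x \<equiv> \<lambda>k l. X $$ (k - 1, l - 1)"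
  shows "Suc (i + m + s) \<le> j \<Longrightarrow>
    down_sum X i (i + m) (Suc (i + m + s)) = pairing x n i (bwd x n (Suc (i + m)) s)"
proof (induction m arbitrary: s)
  case 0
  obtain i' where i': "i = Suc i'" using i by (cases i) auto
  have "down_sum X i i (Suc (i + s)) = A_label X (pt i (Suc (i + s))) / P_label X (pt i (Suc (i + s)))"
    using down_sum_Suc[OF i, of i' "i + s" X] up_sum_start[OF i, of X s] by (simp add: i' down_sum_left)
  then show ?case
    using A_div_P_label[OF I X, of i s] 0 i j by (simp add: x_def)
next
  case (Suc m)
  interpret nonsingular_intervals x n "Suc i" j unfolding x_def by fact
  let ?a = "Suc (i + m)"
  note IH = Suc.IH
  \<comment> \<open>The right-hand side is the coefficient of \<open>e\<^sub>a\<close> in the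
    projection of \<open>e\<^sub>i\<close> onto the span of \<open>a..a+t\<close>;
    \<open>fwd_coefficient_step\<close> matches the recursion of the up sums.\<close>
  have up: "up_sum X i ?a (?a + t) = pairing x n i (fwd x n ?a t) / pairing x n ?a (fwd x n ?a t)"
    if "?a + t < j" for t
    using that
  proof (induction t)
    case 0
    \<comment> \<open>The region above a node on the axis has that node's index as its only inner
      index.\<close>
    have "P_label X (two_above (pt ?a ?a)) = det (block x ?a ?a 1)"
      using P_label_pt[OF X, of "i + m" 1] 0 j by (simp add: two_above_pt x_def)
    also have "\<dots> = pairing x n ?a (fwd x n ?a 0)"
      using det_fwd[of ?a 0] 0 j by (simp add: block_def)
    finally show ?case
      using up_sum_axis[of i "i + m" X] Suc.IH[of 0] 0 i by simp
  next
    case (Suc t)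
    have e1: "up_sum X i ?a (Suc (?a + t)) = up_sum X i ?a (?a + t) + down_sum X i (i + m) (Suc (?a + t)) *
      (A_label X (pt ?a (Suc (?a + t))) / P_label X (two_above (pt ?a (Suc (?a + t)))))"
      using up_sum_Suc[of i "i + m" "?a + t" X] i by simp
    have e2: "down_sum X i (i + m) (Suc (?a + t)) = pairing x n i (bwd x n ?a (Suc t))"
      using Suc.prems IH[of "Suc t"] by simp
    have e3: "A_label X (pt ?a (Suc (?a + t))) / P_label X (two_above (pt ?a (Suc (?a + t))))
       = - (pairing x n ?a (bwd x n (Suc ?a) t) /
           (pairing x n (Suc (?a + t)) (bwd x n (Suc ?a) t) * pairing x n ?a (fwd x n ?a (Suc t))))"
      unfolding x_def using Suc.prems i j by (intro A_div_P_label_above[OF I X]) auto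
    have e4: "up_sum X i ?a (?a + t) = pairing x n i (fwd x n ?a t) / pairing x n ?a (fwd x n ?a t)"
      using Suc by simp
    show ?case
      unfolding add_Suc_right[of ?a] e1 e2 e3 e4
      using fwd_coefficient_step[of ?a t i] Suc.prems j by (simp del: fwd.simps bwd.simps)
  qed
  have "down_sum X i ?a (Suc (?a + s)) = down_sum X i (i + m) (Suc (?a + s)) + up_sum X i ?a (?a + s) *
      (A_label X (pt ?a (Suc (?a + s))) / P_label X (pt ?a (Suc (?a + s))))"
    using down_sum_Suc[of i "i + m" "?a + s" X] i by simp
  also have "\<dots> = pairing x n i (bwd x n ?a (Suc s)) +
      pairing x n i (fwd x n ?a s) / pairing x n ?a (fwd x n ?a s) * pairing x n ?a (bwd x n (Suc ?a) s)"
    using Suc.IH[of "Suc s"] up[of s] A_div_P_label[OF I X, of ?a s] Suc.prems j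
    by (simp add: x_def del: fwd.simps bwd.simps)
  also have "\<dots> = pairing x n i (bwd x n (Suc ?a) s)"
    \<comment> \<open>The term for the local maxima restores exactly what the Gram-Schmidt step had
      subtracted.\<close>
    unfolding pairing_bwd_Suc by simp
  finally show ?case by simp
qed

text \<open>Every interval \<open>a..b\<close> strictly between \<open>i\<close> and
  \<open>j\<close> is the label set of some denominator. Nonvanishing of the denominators that occur
  therefore yields the assumption \<open>nonsing\<close> of the locale.\<close>

lemma interior_denominator:
  assumes "1 \<le> i" "i < a" "a \<le> b" "b < j" "j \<le> n"
  shows "\<exists>C\<in>catalan_paths n i j. pt (a - 1) (Suc b) \<in> denom_regions C"
proof -
  text \<open>Up to \<open>pt i b\<close>, down to the local minimum \<open>pt a b\<close>, up to \<open>pt a j\<close>, down to \<open>pt j j\<close>.\<close>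
  define l where "l k = (if k \<le> b - i then i else if k \<le> a + b - 2 * i then k + 2 * i - b
     else if k \<le> a + j - 2 * i then a else k + 2 * i - j)" for k
  \<comment> \<open>\<open>l k\<close> is the left index after \<open>k\<close> steps; the right
    index follows because the two start with sum \<open>2 * i\<close> and gain 1 per step.\<close>
  define C where "C = map (\<lambda>k. pt (l k) (2 * i + k - l k)) [0..<Suc (2 * (j - i))]"
  have nth: "C ! k = pt (l k) (2 * i + k - l k)" if "k \<le> 2 * (j - i)" for k
    using that by (simp add: C_def del: upt_Suc)
  have len: "length C = Suc (2 * (j - i))" by (simp add: C_def)
  have l: "k \<le> 2 * (j - i) \<Longrightarrow> 2 * l k \<le> 2 * i + k" "l (Suc k) = l k \<or> l (Suc k) = Suc (l k)" for k
    using assms by (auto simp: l_def)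
  have "C \<in> walks i (node j)"
  proof -
    have "hd C = node i" using nth[of 0] len by (simp add: hd_conv_nth node_eq_pt l_def flip: length_greater_0_conv)
    moreover have "l (2 * (j - i)) = j" using assms by (auto simp: l_def)
    then have "last C = node j"
      using nth[of "2 * (j - i)"] len assms
      by (simp add: last_conv_nth node_eq_pt flip: length_greater_0_conv)
    moreover have "(C ! k, C ! Suc k) \<in> steps" if "Suc k < length C" for k
      using that l[of k] l(1)[of "Suc k"] by (auto simp: nth len steps_iff of_nat_diff)
    moreover have "0 \<le> snd w" if w: "w \<in> set C" for w
    proof -
      obtain k where "k \<le> 2 * (j - i)" "w = pt (l k) (2 * i + k - l k)"
        using w by (auto simp: C_def less_Suc_eq_le simp del: upt_Suc)
      then show ?thesis using l(1)[of k] by simp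
    qed
    ultimately show ?thesis using len by (auto simp: walks_def successively_conv_nth)
  qed
  moreover have "pt (a - 1) (Suc b) \<in> denom_regions C"
  proof -
    let ?k = "a + b - 2 * i"
    have k: "0 < ?k" "Suc ?k \<le> 2 * (j - i)" using assms by auto
    have "l ?k = a" "l (?k - 1) = a - 1" "l (Suc ?k) = a" using assms by (auto simp: l_def)
    then have "C ! ?k = pt a b" "C ! (?k - 1) = pt (a - 1) b" "C ! Suc ?k = pt a (Suc b)"
      using nth[of ?k] nth[of "?k - 1"] nth[of "Suc ?k"] k assms by auto
    then have "?k \<in> local_min C" "two_above (C ! ?k) = pt (a - 1) (Suc b)"
      using k assms two_above_pt[of "a - 1" b] by (auto simp: local_min_def len)
    then show ?thesis unfolding denom_regions_def by force
  qed
  ultimately show ?thesis using assms by (auto simp: catalan_paths_eq_walks)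
qed

theorem theorem1p1:
  fixes X :: "'a::field mat" and n i j :: nat
  assumes "n \<ge> 2"
    and "X \<in> carrier_mat n n"
    and "transpose_mat X = X"
    and "1 \<le> i" and "i < j" and "j \<le> n"
    and "\<forall>C \<in> catalan_paths n i j. \<forall>v \<in> denom_regions C.
           minor X (inner_indices v) (inner_indices v) \<noteq> 0"
  shows "X $$ (i - 1, j - 1) = (\<Sum>C \<in> catalan_paths n i j. path_weight X C)"
proof -
  let ?x = "\<lambda>k l. X $$ (k - 1, l - 1)"
  have I: "nonsingular_intervals ?x n (Suc i) j"
  proof
    \<comment> \<open>Index 0 is included and behaves as a copy of index 1 under truncated
      subtraction.\<close>
    fix k l assume "k \<le> n" "l \<le> n"
    then have "k - 1 < n" "l - 1 < n" using assms(1) by auto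
    then show "?x k l = ?x l k"
      using assms(2,3) by (metis carrier_matD index_transpose_mat(1))
  next
    fix a s assume a: "Suc i \<le> a" "a + s < j"
    then have "minor X (inner_indices (pt (a - 1) (Suc (a + s)))) (inner_indices (pt (a - 1) (Suc (a + s)))) \<noteq> 0"
      using interior_denominator[of i a "a + s" j n] assms by auto
    moreover have "inner_indices (pt (a - 1) (Suc (a + s))) = {a..<a + Suc s}"
      using a by (auto simp: inner_indices_def)
    ultimately show "det (block ?x a a (Suc s)) \<noteq> 0"
      using minor_interval[OF assms(2), of a a "Suc s"] a assms by simp
  qed (use assms in simp)
  obtain j' where j': "j = Suc j'" using assms(5) by (cases j) auto
  have "(\<Sum>C \<in> catalan_paths n i j. path_weight X C) = down_sum X i j' j"
    using sum_walks_node[of i j' X] assms j' by (simp add: catalan_paths_eq_walks)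
  \<comment> \<open>The last vertex before node \<open>j\<close> has left index \<open>j'\<close>,
    so \<open>m = j' - i\<close>, and the final interval is the single index
    \<open>j\<close>.\<close>
  also have "\<dots> = pairing ?x n i (bwd ?x n j 0)"
    using walk_sums[OF I assms(2,4,6), of "j' - i" 0] assms(5) j' by simp
  also have "\<dots> = ?x i j"
    using assms(6) by (simp add: pairing_def if_distrib cong: if_cong)
  finally show ?thesis by simp
qed

end
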